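(* Let $\mathcal A$ be a central arrangement in $\mathbb C^{\ell+1}$ with OS algebra $A$, flag space $\mathcal F$, flag differential $d$, weights $a\in\mathbb C^{n+1}$ and contravariant form $S$ (as in the context). Then the subspaces $\operatorname{Ann}(\omega_a\wedge A)$ and $\operatorname{im}(d)$ of $\mathcal F$ are orthogonal with respect to $S$: $S(F,G)=0$ for all $F\in\operatorname{Ann}(\omega_a\wedge A)$ and $G\in\operatorname{im}(d)$.
   Context: Let $\mathcal A=\{H_0,\dots,H_n\}$ be a central arrangement of distinct hyperplanes in $\mathbb C^{\ell+1}$, $H_i=\ker f_i$, with complement $M$, $\omega_i=df_i/f_i$. The OS algebra $A=\bigoplus_pA^p$ is the graded subalgebra of holomorphic forms on $M$ generated by $1,\omega_0,\dots,\omega_n$; $\omega_J=\omega_{j_1}\wedge\cdots\wedge\omega_{j_p}$. Let $L$ be the set of intersections of subfamilies of $\mathcal A$ (including $\mathbb C^{\ell+1}$), ordered by reverse inclusion. A flag of length $p$ is a chain $(X_0<\cdots<X_p)$ in $L$ with $\operatorname{codim}X_i=i$. The flag space $\mathcal F=\bigoplus_p\mathcal F^p$ is the span of flags modulo all sums $\sum_X(X_0<\cdots<X_{i-1}<X<X_{i+1}<\cdots<X_p)$ over $X\in L$ with $X_{i-1}<X<X_{i+1}$, $\operatorname{codim}X=i$ (for all chains $X_0<\cdots<X_{i-1}<X_{i+1}<\cdots<X_p$ with $\operatorname{codim}X_j=j$); images written $[X_0<\cdots<X_p]$. The pairing $\langle\,,\rangle:\mathcal F^p\otimes A^p\to\mathbb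 C$ is $\langle F,\omega_J\rangle=\operatorname{sgn}(\sigma)$ if $F$ equals the chain with $X_0=\mathbb C^{\ell+1}$, $X_k=H_{j_{\sigma(1)}}\cap\cdots\cap H_{j_{\sigma(k)}}$ for some permutation $\sigma$, and $0$ otherwise; it is well defined, nondegenerate, and $\mathcal F^p$ pairs trivially with $A^q$ for $q\ne p$. For $U\subseteq A$, $\operatorname{Ann}(U)=\{F\in\mathcal F:\langle F,u\rangle=0\ \forall u\in U\}$. The flag differential is $d[X_0<\cdots<X_p]=\sum_{X>X_p,\ \operatorname{codim}X=p+1}[X_0<\cdots<X_p<X]$. For $a=(a_0,\dots,a_n)\in\mathbb C^{n+1}$, $\omega_a=\sum_ia_i\omega_i$ and $\omega_a\wedge A=\{\omega_a\wedge x:x\in A\}$. The contravariant form $S=\bigoplus_pS_p$ on $\mathcal F$ has $S_p(F,F')=\sum_Ja_J\langle F,\omega_J\rangle\langle F',\omega_J\rangle$ on $\mathcal F^p$ (sum over increasing $J=(j_1<\cdots<j_p)$ in $\{0,\dots,n\}$, $a_J=\prod_ka_{j_k}$), and $S(\mathcal F^p,\mathcal F^q)=0$ for $p\neq q$. *)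

theory Defs
  imports "HOL-Analysis.Analysis" "HOL-Combinatorics.Permutations" "HOL-Library.Function_Algebras"
begin

definition hyp :: "(nat \<Rightarrow> complex^'m \<Rightarrow> complex) \<Rightarrow> nat \<Rightarrow> (complex^'m) set" where
  "hyp f i = {x. f i x = 0}"

text \<open>The hyperplanes are \<open>hyp f i\<close> for \<open>i \<le> n\<close>, in the complex vector space of dimension
  \<open>CARD('m)\<close>. The values of \<open>f\<close> at indices above \<open>n\<close> are never used.\<close>

definition central_arrangement :: "nat \<Rightarrow> (nat \<Rightarrow> complex^'m \<Rightarrow> complex) \<Rightarrow> bool" where
  "central_arrangement n f \<longleftrightarrow>
     (\<forall>i\<le>n. Vector_Spaces.linear (*s) (*) (f i) \<and> (\<exists>x. f i x \<noteq> 0)) \<and>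
     inj_on (hyp f) {..n}"

definition arr_complement :: "nat \<Rightarrow> (nat \<Rightarrow> complex^'m \<Rightarrow> complex) \<Rightarrow> (complex^'m) set" where
  "arr_complement n f = - (\<Union>i\<le>n. hyp f i)"

text \<open>The empty subfamily contributes the whole space. The order on \<open>intersections\<close> is reverse
  inclusion, so \<open>X < Y\<close> in the poset is written \<open>Y \<subset> X\<close> below.\<close>

definition intersections :: "nat \<Rightarrow> (nat \<Rightarrow> complex^'m \<Rightarrow> complex) \<Rightarrow> (complex^'m) set set" where
  "intersections n f = {(\<Inter>i\<in>I. hyp f i) | I. I \<subseteq> {..n}}"

definition codim :: "(complex^'m) set \<Rightarrow> nat" where
  "codim X = CARD('m) - vec.dim X"

text \<open>A (not necessarily homogeneous) differential form \<open>\<phi>\<close> sends a point \<open>x\<close> and a list of tangent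
  vectors to a number; its component of degree \<open>p\<close> is its restriction to lists of length \<open>p\<close>.
  Forms on the complement are extended by zero to the other points.\<close>

type_synonym 'm form = "complex^'m \<Rightarrow> (complex^'m) list \<Rightarrow> complex"

definition form_one :: "nat \<Rightarrow> (nat \<Rightarrow> complex^'m \<Rightarrow> complex) \<Rightarrow> 'm form" where
  "form_one n f = (\<lambda>x vs. if x \<in> arr_complement n f \<and> vs = [] then 1 else 0)"

text \<open>The logarithmic form \<open>df\<^sub>i / f\<^sub>i\<close>; since \<open>f i\<close> is linear, its differential at every point
  is \<open>f i\<close> itself.\<close>

definition omega :: "nat \<Rightarrow> (nat \<Rightarrow> complex^'m \<Rightarrow> complex) \<Rightarrow> nat \<Rightarrow> 'm form" where
  "omega n f i = (\<lambda>x vs. if x \<in> arr_complement n f \<and> length vs = 1 then f i (hd vs) / f i x else 0)"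

text \<open>The wedge product as a sum over shuffles: \<open>S\<close> is the set of positions of the vectors
  handed to the first factor, and the sign is that of the corresponding shuffle.\<close>

definition shuffle_sign :: "nat \<Rightarrow> nat set \<Rightarrow> complex" where
  "shuffle_sign m S = (- 1) ^ card {(i, j). i \<in> {..<m} - S \<and> j \<in> S \<and> i < j}"

definition wedge :: "'m::finite form \<Rightarrow> 'm form \<Rightarrow> 'm form" where
  "wedge \<phi> \<psi> = (\<lambda>x vs. \<Sum>S \<in> Pow {..<length vs}.
     shuffle_sign (length vs) S * \<phi> x (nths vs S) * \<psi> x (nths vs (- S)))"

inductive_set OS_algebra :: "nat \<Rightarrow> (nat \<Rightarrow> complex^'m \<Rightarrow> complex) \<Rightarrow> 'm form set"
  for n :: nat and f :: "nat \<Rightarrow> complex^'m \<Rightarrow> complex" where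
  one: "form_one n f \<in> OS_algebra n f"
| gen: "i \<le> n \<Longrightarrow> omega n f i \<in> OS_algebra n f"
| scale: "\<phi> \<in> OS_algebra n f \<Longrightarrow> (\<lambda>x vs. c * \<phi> x vs) \<in> OS_algebra n f"
| add: "\<phi> \<in> OS_algebra n f \<Longrightarrow> \<psi> \<in> OS_algebra n f \<Longrightarrow> (\<lambda>x vs. \<phi> x vs + \<psi> x vs) \<in> OS_algebra n f"
| mult: "\<phi> \<in> OS_algebra n f \<Longrightarrow> \<psi> \<in> OS_algebra n f \<Longrightarrow> wedge \<phi> \<psi> \<in> OS_algebra n f"

definition omega_mono :: "nat \<Rightarrow> (nat \<Rightarrow> complex^'m \<Rightarrow> complex) \<Rightarrow> nat list \<Rightarrow> 'm form" where
  "omega_mono n f J = foldr wedge (map (omega n f) J) (form_one n f)"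

definition omega_weight ::
  "nat \<Rightarrow> (nat \<Rightarrow> complex^'m \<Rightarrow> complex) \<Rightarrow> (nat \<Rightarrow> complex) \<Rightarrow> 'm form" where
  "omega_weight n f a = (\<lambda>x vs. \<Sum>i\<le>n. a i * omega n f i x vs)"

definition increasing_tuples :: "nat \<Rightarrow> nat list set" where
  "increasing_tuples n = {J. sorted_wrt (<) J \<and> set J \<subseteq> {..n}}"

text \<open>A flag of length \<open>p\<close> is a list with \<open>p + 1\<close> entries.\<close>

definition flags :: "nat \<Rightarrow> (nat \<Rightarrow> complex^'m \<Rightarrow> complex) \<Rightarrow> (complex^'m) set list set" where
  "flags n f = {G. G \<noteq> [] \<and>
     (\<forall>k<length G. G ! k \<in> intersections n f \<and> codim (G ! k) = k) \<and>
     (\<forall>k. Suc k < length G \<longrightarrow> G ! Suc k \<subset> G ! k)}"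

interpretation fun_vs: vector_space "\<lambda>(c::complex) (g::'a \<Rightarrow> complex) x. c * g x"
  by unfold_locales (auto simp: fun_eq_iff algebra_simps)

text \<open>There are finitely many flags, so the free vector space on them consists of all functions
  vanishing off \<open>flags n f\<close>.\<close>

definition free_flags ::
  "nat \<Rightarrow> (nat \<Rightarrow> complex^'m \<Rightarrow> complex) \<Rightarrow> ((complex^'m) set list \<Rightarrow> complex) set" where
  "free_flags n f = {c. \<forall>G. G \<notin> flags n f \<longrightarrow> c G = 0}"

definition flag_vec :: "(complex^'m) set list \<Rightarrow> (complex^'m) set list \<Rightarrow> complex" where
  "flag_vec G = (\<lambda>G'. if G' = G then 1 else 0)"

text \<open>The relators: \<open>Ys = (X\<^sub>0 < \<dots> < X\<^sub>i\<^sub>-\<^sub>1)\<close> and \<open>Zs = (X\<^sub>i\<^sub>+\<^sub>1 < \<dots> < X\<^sub>p)\<close>,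
  with \<open>i = length Ys\<close> and both parts nonempty, i.e. \<open>0 < i < p\<close>.\<close>

definition flag_relators ::
  "nat \<Rightarrow> (nat \<Rightarrow> complex^'m \<Rightarrow> complex) \<Rightarrow> ((complex^'m) set list \<Rightarrow> complex) set" where
  "flag_relators n f =
     {(\<Sum>X | X \<in> intersections n f \<and> X \<subset> last Ys \<and> hd Zs \<subset> X \<and> codim X = length Ys.
         flag_vec (Ys @ X # Zs)) | Ys Zs.
       Ys \<in> flags n f \<and> Zs \<noteq> [] \<and> hd Zs \<subset> last Ys \<and>
       (\<forall>k<length Zs. Zs ! k \<in> intersections n f \<and> codim (Zs ! k) = length Ys + 1 + k) \<and>
       (\<forall>k. Suc k < length Zs \<longrightarrow> Zs ! Suc k \<subset> Zs ! k)}"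

definition flag_rel ::
  "nat \<Rightarrow> (nat \<Rightarrow> complex^'m \<Rightarrow> complex) \<Rightarrow> ((complex^'m) set list \<Rightarrow> complex) rel" where
  "flag_rel n f = {(c, c'). c \<in> free_flags n f \<and> c' \<in> free_flags n f \<and>
     c - c' \<in> fun_vs.span (flag_relators n f)}"

definition flag_space ::
  "nat \<Rightarrow> (nat \<Rightarrow> complex^'m \<Rightarrow> complex) \<Rightarrow> ((complex^'m) set list \<Rightarrow> complex) set set" where
  "flag_space n f = free_flags n f // flag_rel n f"

definition pre_diff :: "nat \<Rightarrow> (nat \<Rightarrow> complex^'m \<Rightarrow> complex) \<Rightarrow>
    ((complex^'m) set list \<Rightarrow> complex) \<Rightarrow> (complex^'m) set list \<Rightarrow> complex" where
  "pre_diff n f c = (\<lambda>G'. \<Sum>G \<in> flags n f. c G *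
     (\<Sum>X | X \<in> intersections n f \<and> X \<subset> last G \<and> codim X = length G. flag_vec (G @ [X]) G'))"

definition flag_diff :: "nat \<Rightarrow> (nat \<Rightarrow> complex^'m \<Rightarrow> complex) \<Rightarrow>
    ((complex^'m) set list \<Rightarrow> complex) set \<Rightarrow> ((complex^'m) set list \<Rightarrow> complex) set" where
  "flag_diff n f F = (\<Union>c\<in>F. flag_rel n f `` {pre_diff n f c})"

definition chain_of ::
  "(nat \<Rightarrow> complex^'m \<Rightarrow> complex) \<Rightarrow> nat list \<Rightarrow> (nat \<Rightarrow> nat) \<Rightarrow> (complex^'m) set list" where
  "chain_of f J \<sigma> = map (\<lambda>k. \<Inter>i<k. hyp f (J ! \<sigma> i)) [0..<Suc (length J)]"

text \<open>The value of the pairing on a flag and a monomial. For a flag \<open>G\<close> there is at most one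
  such \<open>\<sigma>\<close>.\<close>

definition flag_eval ::
  "(nat \<Rightarrow> complex^'m \<Rightarrow> complex) \<Rightarrow> (complex^'m) set list \<Rightarrow> nat list \<Rightarrow> complex" where
  "flag_eval f G J =
     (if \<exists>\<sigma>. \<sigma> permutes {..<length J} \<and> G = chain_of f J \<sigma>
      then of_int (sign (THE \<sigma>. \<sigma> permutes {..<length J} \<and> G = chain_of f J \<sigma>)) else 0)"

text \<open>The bilinear extension of \<open>flag_eval\<close> to classes of flags and forms in the Orlik-Solomon
  algebra, the latter being linear combinations of the monomials; the value is independent of the
  representative \<open>c\<close> and of the coefficients \<open>b\<close>. Components of different degrees
  pair to zero, because a flag of length \<open>p\<close> equals no chain \<open>chain_of f J \<sigma>\<close>
  with \<open>length J \<noteq> p\<close>.\<close>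

definition flag_pairing :: "nat \<Rightarrow> (nat \<Rightarrow> complex^'m \<Rightarrow> complex) \<Rightarrow>
    ((complex^'m) set list \<Rightarrow> complex) set \<Rightarrow> 'm form \<Rightarrow> complex" where
  "flag_pairing n f F u = (THE z. \<exists>c\<in>F. \<exists>b.
     u = (\<lambda>x vs. \<Sum>J \<in> increasing_tuples n. b J * omega_mono n f J x vs) \<and>
     z = (\<Sum>G \<in> flags n f. \<Sum>J \<in> increasing_tuples n. c G * b J * flag_eval f G J))"

definition Ann :: "nat \<Rightarrow> (nat \<Rightarrow> complex^'m \<Rightarrow> complex) \<Rightarrow> 'm form set \<Rightarrow>
    ((complex^'m) set list \<Rightarrow> complex) set set" where
  "Ann n f U = {F \<in> flag_space n f. \<forall>u\<in>U. flag_pairing n f F u = 0}"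

definition contravariant_deg :: "nat \<Rightarrow> (nat \<Rightarrow> complex^'m \<Rightarrow> complex) \<Rightarrow> (nat \<Rightarrow> complex) \<Rightarrow> nat \<Rightarrow>
    ((complex^'m) set list \<Rightarrow> complex) set \<Rightarrow> ((complex^'m) set list \<Rightarrow> complex) set \<Rightarrow> complex" where
  "contravariant_deg n f a p F F' =
     (\<Sum>J | J \<in> increasing_tuples n \<and> length J = p. (\<Prod>k<p. a (J ! k)) *
        flag_pairing n f F (omega_mono n f J) * flag_pairing n f F' (omega_mono n f J))"

text \<open>The direct sum of the forms above. No projection to the components of degree \<open>p\<close> is needed:
  a monomial of degree \<open>p\<close> only pairs with those components. The degrees
  above \<open>n + 1\<close> contribute nothing, as there are no increasing tuples of that length.\<close>

definition contravariant_form :: "nat \<Rightarrow> (nat \<Rightarrow> complex^'m \<Rightarrow> complex) \<Rightarrow> (nat \<Rightarrow> complex) \<Rightarrow>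
    ((complex^'m) set list \<Rightarrow> complex) set \<Rightarrow> ((complex^'m) set list \<Rightarrow> complex) set \<Rightarrow> complex" where
  "contravariant_form n f a F F' = (\<Sum>p\<le>n + 1. contravariant_deg n f a p F F')"

end

theory Submission
  imports Defs "Jordan_Normal_Form.Determinant"
begin

text \<open>
  Both sides of the pairing are alternants, that is, determinants of values of functions of the
  hyperplane index. A monomial \<open>\<omega>\<^sub>J\<close> evaluates at a point \<open>x\<close> and vectors \<open>v\<^sub>k\<close> to the determinant of
  \<open>f\<^sub>j(v\<^sub>k) / f\<^sub>j(x)\<close>, and its value on a flag is the determinant of the incidences \<open>[X\<^sub>k \<subseteq> H\<^sub>j]\<close>. The
  second matrix is the limit of the first one when \<open>x\<close> is a sum of generic vectors of the spaces
  \<open>X\<^sub>i\<close> growing at successively faster rates and \<open>v\<^sub>k\<close> is a truncation of that sum (an iterated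
  residue), so the pairing only depends on the form.

  Summed over all \<open>X\<close> between \<open>Y\<close> and \<open>Z\<close>, the incidence row of \<open>X\<close> becomes a multiple of the row of
  \<open>Y\<close> plus the row of \<open>Z\<close>. Hence the relators pair to zero, by equal rows. The flag differential is
  the case without \<open>Z\<close>, where the row of \<open>Z\<close> is constantly \<open>1\<close>; expanding along it gives
  \<open>\<langle>d G, \<omega>\<^sub>J\<rangle> = \<plusminus> \<Sum>\<^sub>k (- 1)\<^sup>k \<langle>G, \<omega>\<^sub>J\<^sub>-\<^sub>k\<rangle>\<close>. Substituting this in \<open>S(F, d G)\<close> and regrouping the pairs
  \<open>(J, k)\<close> as pairs \<open>(I, i)\<close> with \<open>J = I \<union> {i}\<close> gives
  \<open>\<Sum>\<^sub>I \<plusminus> a\<^sub>I \<langle>G, \<omega>\<^sub>I\<rangle> \<langle>F, \<omega>\<^sub>a \<and> \<omega>\<^sub>I\<rangle>\<close>, which vanishes for \<open>F\<close> in the annihilator.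
\<close>

section \<open>Lists and finite sums\<close>

lemma nths_Compl_singleton: "nths xs (- {k}) = take k xs @ drop (Suc k) xs"
proof (cases "k < length xs")
  case True
  have "nths (take k xs @ xs ! k # drop (Suc k) xs) (- {k}) = take k xs @ drop (Suc k) xs"
    using True by (simp add: nths_append nths_Cons nths_all)
  then show ?thesis by (simp only: id_take_nth_drop[OF True, symmetric])
qed (simp add: nths_all)

lemma nths_singleton_nth: "k < length xs \<Longrightarrow> nths xs {k} = [xs ! k]"
proof (induction xs arbitrary: k)
  case (Cons x xs)
  then show ?case by (cases k) (simp_all add: nths_Cons)
qed simp

lemma length_nths_Compl_singleton [simp]:
  "k < length xs \<Longrightarrow> length (nths xs (- {k})) = length xs - 1"
  by (simp add: nths_Compl_singleton)

lemma nth_nths_Compl_singleton: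
  "k < length xs \<Longrightarrow> i < length xs - 1 \<Longrightarrow>
    nths xs (- {k}) ! i = xs ! (if i < k then i else Suc i)"
  by (simp add: nths_Compl_singleton nth_append)

lemma nths_Compl_length_append [simp]: "nths (xs @ x # ys) (- {length xs}) = xs @ ys"
  by (simp add: nths_Compl_singleton)

lemma remove1_nth:
  assumes "distinct xs" and k: "k < length xs"
  shows "remove1 (xs ! k) xs = nths xs (- {k})"
proof -
  have "distinct (take k xs @ xs ! k # drop (Suc k) xs)"
    using assms by (simp only: id_take_nth_drop[symmetric])
  then have "remove1 (xs ! k) (take k xs @ xs ! k # drop (Suc k) xs) = nths xs (- {k})"
    by (simp add: remove1_append nths_Compl_singleton)
  then show ?thesis by (simp only: id_take_nth_drop[OF k, symmetric])
qed

lemma zip_snoc_Cons_snoc: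
  "zip (xs @ [x]) (y # xs @ [x]) = zip xs (y # xs) @ [(x, last (y # xs))]"
  by (induction xs arbitrary: y) auto

lemma prod_list_map_nths_Compl_singleton:
  fixes a :: "'a \<Rightarrow> 'b::comm_monoid_mult"
  assumes "k < length xs"
  shows "prod_list (map a xs) = a (xs ! k) * prod_list (map a (nths xs (- {k})))"
proof -
  have "prod_list (map a (take k xs @ xs ! k # drop (Suc k) xs)) =
      a (xs ! k) * prod_list (map a (nths xs (- {k})))"
    by (simp add: nths_Compl_singleton mult_ac)
  then show ?thesis by (simp only: id_take_nth_drop[OF assms, symmetric])
qed

lemma insort_eq_takeWhile_append:
  fixes x :: "'a::linorder"
  shows "insort x xs = takeWhile (\<lambda>y. y < x) xs @ x # dropWhile (\<lambda>y. y < x) xs"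
  by (induction xs) auto

lemma sum_fun_apply: "(\<Sum>x\<in>A. g x) y = (\<Sum>x\<in>A. g x y)"
  by (induction A rule: infinite_finite_induct) auto

lemma prod_of_bool:
  "finite A \<Longrightarrow> (\<Prod>x\<in>A. of_bool (P x) :: 'a::comm_semiring_1) = of_bool (\<forall>x\<in>A. P x)"
  by (induction A rule: finite_induct) auto

section \<open>Polynomials at infinity\<close>

lemma eventually_poly_neq_0_at_infinity:
  fixes p :: "'a::real_normed_field poly"
  assumes "p \<noteq> 0"
  shows "\<forall>\<^sub>F t in at_infinity. poly p t \<noteq> 0"
proof -
  have "\<forall>\<^sub>F t in at_infinity. poly p t / t ^ degree p \<noteq> 0"
    using poly_divide_tendsto_aux[of p] assms by (intro tendsto_imp_eventually_ne) auto
  then show ?thesis by (rule eventually_mono) auto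
qed

lemma poly_cutoff_ratio_tendsto:
  fixes p :: "'a::real_normed_field poly"
  assumes "p \<noteq> 0"
  shows "((\<lambda>t. poly (poly_cutoff k p) t / poly p t) \<longlongrightarrow> of_bool (poly_cutoff k p = p)) at_infinity"
proof -
  consider (equal) "poly_cutoff k p = p" | (zero) "poly_cutoff k p = 0"
    | (proper) "poly_cutoff k p \<notin> {0, p}"
    by blast
  then show ?thesis
  proof cases
    case equal
    have "\<forall>\<^sub>F t in at_infinity. poly p t / poly p t = 1"
      using eventually_poly_neq_0_at_infinity[OF assms] by (rule eventually_mono) simp
    then show ?thesis using equal by (simp add: tendsto_eventually)
  next
    case zero
    then show ?thesis using assms by simp
  next
    case proper
    then have "coeff (poly_cutoff k p) (degree (poly_cutoff k p)) \<noteq> 0" by simp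
    then have "degree (poly_cutoff k p) < k"
      by (simp add: coeff_poly_cutoff split: if_splits)
    also have "k \<le> degree p"
    proof -
      obtain m where "coeff (poly_cutoff k p) m \<noteq> coeff p m"
        using proper by (auto simp: poly_eq_iff)
      then have "k \<le> m" "coeff p m \<noteq> 0"
        by (auto simp: coeff_poly_cutoff split: if_splits)
      then show ?thesis using le_degree le_trans by blast
    qed
    finally show ?thesis
      using proper poly_divide_tendsto_0_at_infinity by auto
  qed
qed

lemma coeff_sum_lessThan_monom: "coeff (\<Sum>i<N. monom (c i) i) k = (if k < N then c k else 0)"
  by (simp add: coeff_sum)

lemma poly_cutoff_sum_lessThan_monom:
  "k \<le> N \<Longrightarrow> poly_cutoff k (\<Sum>i<N. monom (c i) i) = (\<Sum>i<k. monom (c i) i)"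
  by (auto simp: poly_eq_iff coeff_poly_cutoff coeff_sum_lessThan_monom)

section \<open>Alternant determinants\<close>

definition alternant :: "('b \<Rightarrow> 'a::comm_ring_1) list \<Rightarrow> 'b list \<Rightarrow> 'a" where
  "alternant us J = Determinant.det (mat (length us) (length J) (\<lambda>(k, i). (us ! k) (J ! i)))"

lemma alternant_length_neq: "length us \<noteq> length J \<Longrightarrow> alternant us J = 0"
  by (simp add: alternant_def Determinant.det_def)

lemma alternant_Nil [simp]: "alternant [] [] = 1"
  by (simp add: alternant_def)

lemma alternant_leibniz:
  assumes "length us = length J"
  shows "alternant us J =
    (\<Sum>\<sigma> | \<sigma> permutes {..<length J}. of_int (sign \<sigma>) * (\<Prod>k<length J. (us ! k) (J ! \<sigma> k)))"
proof -
  let ?p = "length J" and ?A = "mat (length J) (length J) (\<lambda>(k, i). (us ! k) (J ! i))"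
  have "?A \<in> carrier_mat ?p ?p" by simp
  from det_def'[OF this]
  have "alternant us J = (\<Sum>\<sigma> | \<sigma> permutes {..<?p}. of_int (sign \<sigma>) * (\<Prod>k<?p. ?A $$ (k, \<sigma> k)))"
    unfolding alternant_def assms by (simp only: atLeast0LessThan)
  also have "\<dots> = (\<Sum>\<sigma> | \<sigma> permutes {..<?p}. of_int (sign \<sigma>) * (\<Prod>k<?p. (us ! k) (J ! \<sigma> k)))"
  proof (rule sum.cong)
    fix \<sigma> assume "\<sigma> \<in> {\<sigma>. \<sigma> permutes {..<?p}}"
    then have "\<sigma> k < ?p" if "k < ?p" for k
      using that permutes_in_image[of \<sigma> "{..<?p}" k] by simp
    then show "of_int (sign \<sigma>) * (\<Prod>k<?p. ?A $$ (k, \<sigma> k)) =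
        of_int (sign \<sigma>) * (\<Prod>k<?p. (us ! k) (J ! \<sigma> k))"
      by simp
  qed simp
  finally show ?thesis .
qed

lemma cofactor_alternant:
  assumes "length us = length J" "k < length us" "i < length J"
  shows "cofactor (mat (length J) (length J) (\<lambda>(k, i). (us ! k) (J ! i))) k i =
    (-1) ^ (k + i) * alternant (nths us (- {k})) (nths J (- {i}))"
proof -
  have "mat_delete (mat (length J) (length J) (\<lambda>(k, i). (us ! k) (J ! i))) k i =
      mat (length J - 1) (length J - 1) (\<lambda>(k', i'). (nths us (- {k}) ! k') (nths J (- {i}) ! i'))"
    unfolding mat_delete_def using assms by (auto simp: nth_nths_Compl_singleton intro!: cong_mat)
  then show ?thesis using assms by (simp add: cofactor_def alternant_def)
qed

lemma alternant_row_expansion: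
  assumes "k < length us"
  shows "alternant us J = (\<Sum>i<length J. (-1) ^ (k + i) * (us ! k) (J ! i) *
    alternant (nths us (- {k})) (nths J (- {i})))"
proof (cases "length us = length J")
  case True
  let ?A = "mat (length us) (length J) (\<lambda>(k, i). (us ! k) (J ! i))"
  have "alternant us J = (\<Sum>i<length J. ?A $$ (k, i) * cofactor ?A k i)"
    unfolding alternant_def using assms True by (intro laplace_expansion_row) auto
  then show ?thesis using assms True by (simp add: cofactor_alternant mult_ac)
next
  case False
  then have "alternant (nths us (- {k})) (nths J (- {i})) = 0" if "i < length J" for i
    using assms that by (intro alternant_length_neq) (simp; linarith)
  then show ?thesis using False by (simp add: alternant_length_neq)
qed

lemma alternant_transpose: "alternant us J = alternant (map (\<lambda>j u. u j) J) us"
proof (cases "length us = length J")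
  case True
  let ?A = "mat (length J) (length J) (\<lambda>(k, i). (us ! k) (J ! i))"
  have "transpose_mat ?A = mat (length J) (length J) (\<lambda>(i, k). (map (\<lambda>j u. u j) J ! i) (us ! k))"
    by (intro eq_matI) simp_all
  moreover have "Determinant.det (transpose_mat ?A) = Determinant.det ?A"
    by (rule det_transpose[of _ "length J"]) simp
  ultimately show ?thesis using True by (simp add: alternant_def)
qed (simp add: alternant_length_neq)

lemma alternant_column_expansion:
  assumes "i < length J"
  shows "alternant us J = (\<Sum>k<length us. (-1) ^ (k + i) * (us ! k) (J ! i) *
    alternant (nths us (- {k})) (nths J (- {i})))"
proof -
  have "alternant us J = (\<Sum>k<length us. (-1) ^ (i + k) * (us ! k) (J ! i) *
      alternant (map (\<lambda>j u. u j) (nths J (- {i}))) (nths us (- {k})))"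
    using assms by (subst alternant_transpose, subst alternant_row_expansion[of i])
      (simp_all add: nths_map)
  then show ?thesis by (simp only: alternant_transpose[symmetric] add.commute)
qed

lemma alternant_row_append_expansion:
  "alternant (us @ u # vs) J = (\<Sum>i<length J. (-1) ^ (length us + i) * u (J ! i) *
    alternant (us @ vs) (nths J (- {i})))"
  by (subst alternant_row_expansion[where k = "length us"]) simp_all

lemma alternant_Cons_column_expansion:
  "alternant us (j # J) = (\<Sum>k<length us. (-1) ^ k * (us ! k) j * alternant (nths us (- {k})) J)"
  by (subst alternant_column_expansion[of 0]) (simp_all add: nths_Compl_singleton)

lemma alternant_row_sum:
  "alternant (us @ (\<lambda>j. \<Sum>x\<in>T. g x j) # vs) J = (\<Sum>x\<in>T. alternant (us @ g x # vs) J)"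
  unfolding alternant_row_append_expansion sum_distrib_left sum_distrib_right
  by (rule sum.swap)

lemma alternant_row_add_scale:
  "alternant (us @ (\<lambda>j. c * u j + v j) # vs) J =
    c * alternant (us @ u # vs) J + alternant (us @ v # vs) J"
  unfolding alternant_row_append_expansion sum_distrib_left
  by (simp add: algebra_simps sum.distrib)

lemma alternant_row_zero: "0 \<in> set us \<Longrightarrow> alternant us J = 0"
  by (auto simp: in_set_conv_decomp alternant_row_append_expansion)

lemma alternant_repeated_row:
  assumes "\<not> distinct us"
  shows "alternant us J = 0"
proof (cases "length us = length J")
  case True
  obtain k l where "k < length us" "l < length us" "k \<noteq> l" "us ! k = us ! l"
    using assms by (auto simp: distinct_conv_nth)
  then show ?thesis
    unfolding alternant_def using True
    by (intro det_identical_rows[of _ "length us" k l]) (auto intro!: eq_vecI)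
qed (simp add: alternant_length_neq)

lemma alternant_repeated_column: "\<not> distinct J \<Longrightarrow> alternant us J = 0"
  by (subst alternant_transpose) (simp add: alternant_repeated_row distinct_map)

lemma alternant_move_to_front:
  assumes "i < length J"
  shows "alternant us J = (-1) ^ i * alternant us (J ! i # nths J (- {i}))"
  unfolding alternant_column_expansion[OF assms] alternant_Cons_column_expansion sum_distrib_left
  by (simp add: power_add mult_ac)

lemma alternant_Cons_eq_insort:
  fixes j :: "'b::linorder"
  shows "alternant us (j # J) =
    (-1) ^ length (takeWhile (\<lambda>i. i < j) J) * alternant us (insort j J)"
proof -
  let ?k = "length (takeWhile (\<lambda>i. i < j) J)"
  have "insort j J ! ?k = j" "nths (insort j J) (- {?k}) = J"
    by (simp_all add: insort_eq_takeWhile_append)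
  then have "alternant us (insort j J) = (-1) ^ ?k * alternant us (j # J)"
    using alternant_move_to_front[of ?k "insort j J" us]
    by (simp add: length_takeWhile_le le_imp_less_Suc)
  then show ?thesis
    by (simp flip: mult.assoc power_mult_distrib)
qed

lemma alternant_eq_sort:
  fixes J :: "'b::linorder list"
  shows "\<exists>s. \<forall>us :: ('b \<Rightarrow> 'a::comm_ring_1) list. alternant us J = s * alternant us (sort J)"
proof (induction J)
  case Nil
  show ?case by (intro exI[of _ 1]) simp
next
  case (Cons j J)
  then obtain s where s: "alternant us J = s * alternant us (sort J)" for us :: "('b \<Rightarrow> 'a) list"
    by blast
  have "alternant us (j # J) = s * alternant us (j # sort J)" for us :: "('b \<Rightarrow> 'a) list"
    unfolding alternant_Cons_column_expansion s sum_distrib_left by (simp add: mult_ac)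
  then show ?case
    by (intro exI[of _ "s * (-1) ^ length (takeWhile (\<lambda>i. i < j) (sort J))"])
      (simp add: alternant_Cons_eq_insort[of _ j "sort J"] mult.assoc)
qed

lemma alternant_successive_differences:
  "alternant (map2 (-) us (0 # us)) J = alternant us J"
proof (induction us arbitrary: J rule: rev_induct)
  case (snoc u us)
  let ?d = "map2 (-) us (0 # us)" and ?l = "last (0 # us)"
  have split: "map2 (-) (us @ [u]) (0 # us @ [u]) = ?d @ [\<lambda>j. (-1) * ?l j + u j]"
    unfolding zip_snoc_Cons_snoc by (simp add: fun_eq_iff)
  have expand: "alternant (?d @ [v]) J = alternant (us @ [v]) J" for v
    unfolding alternant_row_append_expansion by (simp add: snoc.IH)
  have "alternant (us @ [?l]) J = 0"
    by (cases "us = []") (simp_all add: alternant_row_zero alternant_repeated_row)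
  then show ?case
    unfolding split alternant_row_add_scale expand by simp
qed simp

lemma tendsto_alternant:
  fixes us :: "'c \<Rightarrow> ('b \<Rightarrow> 'a::{comm_ring_1, real_normed_algebra_1}) list"
  assumes length: "\<And>t. length (us t) = length vs"
    and entries: "\<And>k j. k < length vs \<Longrightarrow> j \<in> set J \<Longrightarrow> ((\<lambda>t. (us t ! k) j) \<longlongrightarrow> (vs ! k) j) F"
  shows "((\<lambda>t. alternant (us t) J) \<longlongrightarrow> alternant vs J) F"
proof (cases "length vs = length J")
  case True
  have "((\<lambda>t. (us t ! k) (J ! \<sigma> k)) \<longlongrightarrow> (vs ! k) (J ! \<sigma> k)) F"
    if "\<sigma> permutes {..<length J}" "k < length J" for \<sigma> k
    using that True permutes_in_image[of \<sigma> "{..<length J}" k] by (intro entries) simp_all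
  then show ?thesis
    unfolding alternant_leibniz[OF trans[OF length True]] alternant_leibniz[OF True]
    by (intro tendsto_sum tendsto_mult_left tendsto_prod) simp_all
qed (simp add: length alternant_length_neq)

section \<open>Increasing tuples\<close>

lemma increasing_tuples_iff:
  "J \<in> increasing_tuples n \<longleftrightarrow> sorted J \<and> distinct J \<and> set J \<subseteq> {..n}"
  by (auto simp: increasing_tuples_def strict_sorted_iff)

lemma length_increasing_tuple: "J \<in> increasing_tuples n \<Longrightarrow> length J \<le> Suc n"
  using card_mono[of "{..n}" "set J"] by (simp add: increasing_tuples_iff distinct_card)

lemma finite_increasing_tuples [simp]: "finite (increasing_tuples n)"
  by (rule finite_subset[OF _ finite_subset_distinct[of "{..n}"]])
    (auto simp: increasing_tuples_iff)

lemma sort_in_increasing_tuples: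
  "distinct J \<Longrightarrow> set J \<subseteq> {..n} \<Longrightarrow> sort J \<in> increasing_tuples n"
  by (simp add: increasing_tuples_iff)

lemma sum_increasing_tuples_delete:
  "(\<Sum>J\<in>increasing_tuples n. \<Sum>k<length J. h (J ! k) (nths J (- {k}))) =
    (\<Sum>I\<in>increasing_tuples n. \<Sum>i\<in>{..n} - set I. h i I)"
proof -
  let ?I = "increasing_tuples n"
  have "(\<Sum>k<length J. h (J ! k) (nths J (- {k}))) = (\<Sum>j\<in>set J. h j (remove1 j J))"
    if "J \<in> ?I" for J
  proof -
    have J: "distinct J" using that by (simp add: increasing_tuples_iff)
    then have "(\<Sum>j\<in>set J. h j (remove1 j J)) = (\<Sum>k<length J. h (J ! k) (remove1 (J ! k) J))"
      by (intro sum.reindex_bij_betw[symmetric] bij_betw_nth) simp_all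
    then show ?thesis by (simp add: remove1_nth[OF J])
  qed
  then have "(\<Sum>J\<in>?I. \<Sum>k<length J. h (J ! k) (nths J (- {k}))) =
      (\<Sum>(J, j)\<in>(SIGMA J:?I. set J). h j (remove1 j J))"
    by (simp add: sum.Sigma)
  also have "\<dots> = (\<Sum>(I, i)\<in>(SIGMA I:?I. {..n} - set I). h i I)"
    by (rule sum.reindex_bij_witness[where j = "\<lambda>(J, j). (remove1 j J, j)"
          and i = "\<lambda>(I, i). (insort i I, i)"])
      (auto simp: increasing_tuples_iff insort_remove1 sorted_remove1 sorted_insort distinct_insort
        set_insort_key dest: set_remove1_subset[THEN subsetD])
  also have "\<dots> = (\<Sum>I\<in>?I. \<Sum>i\<in>{..n} - set I. h i I)"
    by (simp add: sum.Sigma)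
  finally show ?thesis .
qed

section \<open>Monomials in the logarithmic forms\<close>

lemma shuffle_sign_singleton:
  assumes "k < m"
  shows "shuffle_sign m {k} = (-1) ^ k"
proof -
  have "{(i, j). i \<in> {..<m} - {k} \<and> j \<in> {k} \<and> i < j} = {..<k} \<times> {k}"
    using assms by auto
  then show ?thesis by (simp add: shuffle_sign_def)
qed

lemma wedge_one_form:
  assumes "\<And>vs. length vs \<noteq> 1 \<Longrightarrow> \<phi> x vs = 0"
  shows "wedge \<phi> \<psi> x vs = (\<Sum>k<length vs. (-1) ^ k * \<phi> x [vs ! k] * \<psi> x (nths vs (- {k})))"
proof -
  let ?t = "\<lambda>S. shuffle_sign (length vs) S * \<phi> x (nths vs S) * \<psi> x (nths vs (- S))"
  have "?t S = 0" if S: "S \<subseteq> {..<length vs}" "S \<notin> (\<lambda>k. {k}) ` {..<length vs}" for S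
  proof -
    have "{i. i < length vs \<and> i \<in> S} = S" using S(1) by auto
    moreover have "card S \<noteq> 1" using S by (auto simp: card_1_singleton_iff)
    ultimately show ?thesis by (simp add: assms length_nths)
  qed
  then have "sum ?t (Pow {..<length vs}) = sum ?t ((\<lambda>k. {k}) ` {..<length vs})"
    by (intro sum.mono_neutral_right) auto
  also have "\<dots> = (\<Sum>k<length vs. ?t {k})"
    by (subst sum.reindex) (auto simp: inj_on_def)
  finally show ?thesis
    by (simp add: wedge_def nths_singleton_nth shuffle_sign_singleton)
qed

lemma wedge_omega:
  "wedge (omega n f i) \<psi> x vs =
    (\<Sum>k<length vs. (-1) ^ k * omega n f i x [vs ! k] * \<psi> x (nths vs (- {k})))"
  by (rule wedge_one_form) (simp add: omega_def)

lemma wedge_omega_weight: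
  "wedge (omega_weight n f a) \<psi> = (\<lambda>x vs. \<Sum>i\<le>n. a i * wedge (omega n f i) \<psi> x vs)"
proof (intro ext)
  fix x vs
  have "wedge (omega_weight n f a) \<psi> x vs =
      (\<Sum>k<length vs. (-1) ^ k * omega_weight n f a x [vs ! k] * \<psi> x (nths vs (- {k})))"
    by (rule wedge_one_form) (simp add: omega_weight_def omega_def)
  then show "wedge (omega_weight n f a) \<psi> x vs = (\<Sum>i\<le>n. a i * wedge (omega n f i) \<psi> x vs)"
    unfolding wedge_omega omega_weight_def sum_distrib_left sum_distrib_right
    by (subst sum.swap) (simp add: mult_ac)
qed

lemma omega_mono_Cons: "omega_mono n f (i # J) = wedge (omega n f i) (omega_mono n f J)"
  by (simp add: omega_mono_def)

lemma omega_mono_in_OS_algebra: "set J \<subseteq> {..n} \<Longrightarrow> omega_mono n f J \<in> OS_algebra n f"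
proof (induction J)
  case Nil
  show ?case by (simp add: omega_mono_def OS_algebra.one)
next
  case (Cons i J)
  then show ?case by (auto simp: omega_mono_Cons intro!: OS_algebra.mult OS_algebra.gen)
qed

lemma omega_mono_eq_alternant:
  "omega_mono n f J x vs =
    (if x \<in> arr_complement n f then alternant (map (\<lambda>v j. f j v / f j x) vs) J else 0)"
proof (induction J arbitrary: vs)
  case Nil
  show ?case by (cases "vs = []") (simp_all add: omega_mono_def form_one_def alternant_length_neq)
next
  case (Cons i J)
  show ?case
    unfolding omega_mono_Cons wedge_omega alternant_Cons_column_expansion
    by (simp add: Cons.IH omega_def nths_map)
qed

lemma omega_mono_repeated: "\<not> distinct J \<Longrightarrow> omega_mono n f J = (\<lambda>x vs. 0)"
  by (simp add: fun_eq_iff omega_mono_eq_alternant alternant_repeated_column)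

lemma omega_mono_eq_sort: "\<exists>s. omega_mono n f J = (\<lambda>x vs. s * omega_mono n f (sort J) x vs)"
  using alternant_eq_sort[where 'a = complex, of J]
  by (auto simp: fun_eq_iff omega_mono_eq_alternant)

lemma omega_mono_eq_increasing:
  assumes "set J \<subseteq> {..n}"
  shows "\<exists>s. \<exists>K\<in>increasing_tuples n. omega_mono n f J = (\<lambda>x vs. s * omega_mono n f K x vs)"
proof (cases "distinct J")
  case True
  then show ?thesis
    using omega_mono_eq_sort sort_in_increasing_tuples[OF True assms] by blast
next
  case False
  then show ?thesis
    by (intro exI[of _ 0] bexI[of _ "[]"]) (simp_all add: omega_mono_repeated increasing_tuples_iff)
qed

lemma omega_mono_combination_eq_increasing:
  assumes "finite T" and "\<And>t. t \<in> T \<Longrightarrow> set (K t) \<subseteq> {..n}"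
  shows "\<exists>b'. (\<lambda>x vs. \<Sum>t\<in>T. b t * omega_mono n f (K t) x vs) =
    (\<lambda>x vs. \<Sum>J\<in>increasing_tuples n. b' J * omega_mono n f J x vs)"
proof -
  have "\<forall>t\<in>T. \<exists>s J. J \<in> increasing_tuples n \<and>
      omega_mono n f (K t) = (\<lambda>x vs. s * omega_mono n f J x vs)"
    using omega_mono_eq_increasing assms(2) by blast
  then obtain s L where L: "\<And>t. t \<in> T \<Longrightarrow> L t \<in> increasing_tuples n"
    and s: "\<And>t. t \<in> T \<Longrightarrow> omega_mono n f (K t) = (\<lambda>x vs. s t * omega_mono n f (L t) x vs)"
    by metis
  have "(\<Sum>t\<in>T. b t * omega_mono n f (K t) x vs) =
      (\<Sum>J\<in>increasing_tuples n. (\<Sum>t | t \<in> T \<and> L t = J. b t * s t) * omega_mono n f J x vs)" for x vs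
  proof -
    have "(\<Sum>t\<in>T. b t * omega_mono n f (K t) x vs) =
        (\<Sum>J\<in>increasing_tuples n. \<Sum>t | t \<in> T \<and> L t = J. b t * omega_mono n f (K t) x vs)"
      using L assms(1) by (intro sum.group[symmetric]) auto
    then show ?thesis by (simp add: s sum_distrib_right mult.assoc)
  qed
  then show ?thesis by (intro exI ext)
qed

section \<open>Intersections of hyperplanes\<close>

lemma codim_UNIV [simp]: "codim (UNIV :: (complex^'m) set) = 0"
  unfolding codim_def by (metis vec.dim_eq_full vec.span_UNIV vec_dim_card diff_self_eq_0)

lemma subset_eq_codim_imp_eq:
  fixes X Y :: "(complex^'m) set"
  assumes "vec.subspace X" "vec.subspace Y" "X \<subseteq> Y" "codim X = codim Y"
  shows "X = Y"
proof (rule vec.subspace_dim_equal)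
  have "vec.dim X \<le> CARD('m)" "vec.dim Y \<le> CARD('m)"
    by (rule dim_subset_UNIV_cart_gen)+
  with assms(4) show "vec.dim Y \<le> vec.dim X"
    by (simp add: codim_def)
qed (use assms in simp_all)

locale arrangement =
  fixes n :: nat and f :: "nat \<Rightarrow> complex^'m \<Rightarrow> complex"
  assumes central: "central_arrangement n f"
begin

lemma
  assumes "i \<le> n"
  shows f_scale: "f i (c *s x) = c * f i x"
    and f_diff: "f i (x - y) = f i x - f i y"
    and f_sum: "f i (sum g T) = (\<Sum>t\<in>T. f i (g t))"
    and subspace_hyp: "vec.subspace (hyp f i)"
proof -
  interpret Vector_Spaces.linear "(*s)" "(*)" "f i"
    using central assms by (simp add: central_arrangement_def)
  show "f i (c *s x) = c * f i x" "f i (x - y) = f i x - f i y"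
    "f i (sum g T) = (\<Sum>t\<in>T. f i (g t))"
    by (rule scale diff sum)+
  show "vec.subspace (hyp f i)" unfolding hyp_def by (rule subspace_kernel)
qed

lemma subspace_intersection: "X \<in> intersections n f \<Longrightarrow> vec.subspace X"
  by (auto simp: intersections_def intro!: vec.subspace_Inter subspace_hyp)

lemma zero_in_intersection: "X \<in> intersections n f \<Longrightarrow> 0 \<in> X"
  by (intro vec.subspace_0 subspace_intersection)

lemma finite_intersections [simp]: "finite (intersections n f)"
proof -
  have "intersections n f = (\<lambda>I. \<Inter>i\<in>I. hyp f i) ` Pow {..n}"
    by (auto simp: intersections_def)
  then show ?thesis by simp
qed

lemma inter_hyp_in_intersections:
  assumes "X \<in> intersections n f" "j \<le> n"
  shows "X \<inter> hyp f j \<in> intersections n f"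
proof -
  obtain I where "I \<subseteq> {..n}" "X = (\<Inter>i\<in>I. hyp f i)"
    using assms(1) by (auto simp: intersections_def)
  then show ?thesis
    using assms(2) unfolding intersections_def by (auto intro!: exI[of _ "insert j I"])
qed

lemma codim_inter_hyp:
  assumes X: "X \<in> intersections n f" and j: "j \<le> n" and "\<not> X \<subseteq> hyp f j"
  shows "codim (X \<inter> hyp f j) = Suc (codim X)"
proof -
  let ?K = "X \<inter> hyp f j"
  obtain y where y: "y \<in> X" "f j y \<noteq> 0"
    using assms(3) by (auto simp: hyp_def)
  have subspace: "vec.subspace X" "vec.subspace ?K"
    using X j by (simp_all add: subspace_intersection inter_hyp_in_intersections)
  have "vec.span (insert y ?K) = X"
  proof
    show "vec.span (insert y ?K) \<subseteq> X"
      using y subspace by (intro vec.span_minimal) auto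
    show "X \<subseteq> vec.span (insert y ?K)"
    proof
      fix x assume "x \<in> X"
      then have "x - (f j x / f j y) *s y \<in> ?K"
        using y j subspace(1)
        by (simp add: hyp_def vec.subspace_diff vec.subspace_scale f_diff f_scale)
      then show "x \<in> vec.span (insert y ?K)"
        unfolding vec.span_breakdown_eq by (blast intro: vec.span_base)
    qed
  qed
  then have "vec.dim X = vec.dim (insert y ?K)"
    by (metis vec.dim_span)
  also have "\<dots> = Suc (vec.dim ?K)"
  proof -
    have span: "vec.span ?K = ?K" using subspace(2) by (simp only: vec.span_eq_iff)
    have "y \<notin> vec.span ?K" unfolding span using y by (simp add: hyp_def)
    then show ?thesis by (simp add: vec.dim_insert)
  qed
  finally have "vec.dim X = Suc (vec.dim ?K)" .
  moreover have "vec.dim X \<le> CARD('m)"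
    by (rule dim_subset_UNIV_cart_gen)
  ultimately show ?thesis by (simp add: codim_def)
qed

lemma cover_eq_inter_hyp:
  assumes "X \<in> intersections n f" "Y \<in> intersections n f" "X \<subseteq> Y" "codim X = Suc (codim Y)"
    and "j \<le> n" "X \<subseteq> hyp f j" "\<not> Y \<subseteq> hyp f j"
  shows "X = Y \<inter> hyp f j"
  using assms by (intro subset_eq_codim_imp_eq)
    (auto simp: codim_inter_hyp inter_hyp_in_intersections subspace_intersection)

definition localization :: "(complex^'m) set \<Rightarrow> nat set" where
  "localization X = {j. j \<le> n \<and> X \<subseteq> hyp f j}"

abbreviation localization_indicator :: "(complex^'m) set \<Rightarrow> nat \<Rightarrow> complex" ("\<chi>") where
  "\<chi> X \<equiv> indicator (localization X)"

lemma localization_antimono: "X \<subseteq> Y \<Longrightarrow> localization Y \<subseteq> localization X"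
  by (auto simp: localization_def)

lemma localization_UNIV [simp]: "localization UNIV = {}"
  using central by (auto simp: localization_def central_arrangement_def hyp_def)

lemma localization_empty [simp]: "localization {} = {..n}"
  by (auto simp: localization_def)

definition covers_between :: "(complex^'m) set \<Rightarrow> (complex^'m) set \<Rightarrow> (complex^'m) set set" where
  "covers_between Y Z =
    {X \<in> intersections n f. X \<subset> Y \<and> Z \<subset> X \<and> codim X = Suc (codim Y)}"

lemma finite_covers_between [simp]: "finite (covers_between Y Z)"
  by (simp add: covers_between_def)

text \<open>A hyperplane containing \<open>Y\<close> contains every cover; any other hyperplane \<open>H\<close> contains only the
  cover \<open>Y \<inter> H\<close>, which lies above \<open>Z\<close> exactly if \<open>H\<close> contains \<open>Z\<close>.\<close>

lemma sum_localization_indicator_covers: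
  assumes Y: "Y \<in> intersections n f" and "Z \<subseteq> Y"
    and Z: "\<And>X. X \<in> intersections n f \<Longrightarrow> codim X = Suc (codim Y) \<Longrightarrow> X \<noteq> Z"
  shows "(\<Sum>X\<in>covers_between Y Z. \<chi> X j) =
    (of_nat (card (covers_between Y Z)) - 1) * \<chi> Y j + \<chi> Z j"
proof -
  let ?C = "covers_between Y Z"
  consider (no_hyp) "n < j" | (contains_Y) "j \<le> n" "Y \<subseteq> hyp f j"
    | (cuts_Y) "j \<le> n" "\<not> Y \<subseteq> hyp f j"
    by linarith
  then show ?thesis
  proof cases
    case no_hyp
    then show ?thesis by (simp add: localization_def)
  next
    case contains_Y
    then have "\<chi> X j = 1" if "X \<subseteq> Y" for X
      using that by (auto simp: localization_def)
    moreover have "X \<subseteq> Y" if "X \<in> ?C" for X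
      using that by (auto simp: covers_between_def)
    ultimately show ?thesis using \<open>Z \<subseteq> Y\<close> by simp
  next
    case cuts_Y
    have "\<chi> X j = of_bool (X = Y \<inter> hyp f j)" if "X \<in> ?C" for X
    proof -
      have "X \<subseteq> hyp f j \<longleftrightarrow> X = Y \<inter> hyp f j"
        using that cuts_Y Y cover_eq_inter_hyp[of X Y j] unfolding covers_between_def by blast
      then show ?thesis using cuts_Y by (simp add: localization_def indicator_def)
    qed
    then have "(\<Sum>X\<in>?C. \<chi> X j) = of_bool (Y \<inter> hyp f j \<in> ?C)"
      by (simp add: of_bool_def)
    also have "Y \<inter> hyp f j \<in> ?C \<longleftrightarrow> Z \<subseteq> hyp f j"
      using cuts_Y Y \<open>Z \<subseteq> Y\<close> Z[of "Y \<inter> hyp f j"] inter_hyp_in_intersections[OF Y, of j]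
        codim_inter_hyp[OF Y, of j]
      unfolding covers_between_def by blast
    finally show ?thesis using cuts_Y by (simp add: localization_def)
  qed
qed

section \<open>Flags\<close>

definition codim_chain :: "nat \<Rightarrow> (complex^'m) set list \<Rightarrow> bool" where
  "codim_chain m G \<longleftrightarrow> (\<forall>k<length G. G ! k \<in> intersections n f \<and> codim (G ! k) = m + k) \<and>
    (\<forall>k. Suc k < length G \<longrightarrow> G ! Suc k \<subset> G ! k)"

lemma flags_iff_codim_chain: "G \<in> flags n f \<longleftrightarrow> G \<noteq> [] \<and> codim_chain 0 G"
  by (simp add: flags_def codim_chain_def)

lemma codim_chain_Nil [simp]: "codim_chain m []"
  by (simp add: codim_chain_def)

lemma codim_chain_Cons:
  "codim_chain m (X # G) \<longleftrightarrow> X \<in> intersections n f \<and> codim X = m \<and> codim_chain (Suc m) G \<and>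
    (G = [] \<or> hd G \<subset> X)"
  by (cases G) (auto simp: codim_chain_def All_less_Suc2)

lemma codim_chain_append:
  "codim_chain m (G @ G') \<longleftrightarrow> codim_chain m G \<and> codim_chain (m + length G) G' \<and>
    (G = [] \<or> G' = [] \<or> hd G' \<subset> last G)"
  by (induction G arbitrary: m) (auto simp: codim_chain_Cons)

lemma
  assumes "G \<in> flags n f"
  shows flag_nonempty: "G \<noteq> []"
    and flag_nth: "k < length G \<Longrightarrow> G ! k \<in> intersections n f"
    and flag_codim: "k < length G \<Longrightarrow> codim (G ! k) = k"
    and flag_step: "Suc k < length G \<Longrightarrow> G ! Suc k \<subset> G ! k"
  using assms by (auto simp: flags_def)

lemma flag_eq_UNIV_Cons:
  assumes G: "G \<in> flags n f"
  shows "G = UNIV # tl G"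
proof -
  have "G ! 0 = UNIV"
    using G by (intro subset_eq_codim_imp_eq)
      (auto simp: flag_nonempty flag_nth flag_codim subspace_intersection)
  then show ?thesis using flag_nonempty[OF G] by (cases G) simp_all
qed

lemma
  assumes "G \<in> flags n f"
  shows flag_last: "last G \<in> intersections n f"
    and flag_codim_last: "Suc (codim (last G)) = length G"
  using flag_nonempty[OF assms] flag_nth[OF assms] flag_codim[OF assms]
  by (simp_all add: last_conv_nth)

lemma flag_antimono:
  assumes "G \<in> flags n f" "k \<le> l" "l < length G"
  shows "G ! l \<subseteq> G ! k"
  using assms(2,3)
proof (induction l rule: dec_induct)
  case (step l)
  then show ?case using flag_step[OF assms(1), of l] by auto
qed simp

lemma finite_flags [simp]: "finite (flags n f)"
proof (rule finite_subset)
  show "flags n f \<subseteq> {G. set G \<subseteq> intersections n f \<and> distinct G}"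
  proof
    fix G assume G: "G \<in> flags n f"
    have "distinct G"
      using flag_codim[OF G] by (metis distinct_conv_nth)
    then show "G \<in> {G. set G \<subseteq> intersections n f \<and> distinct G}"
      using flag_nth[OF G] by (auto simp: in_set_conv_nth)
  qed
qed (simp add: finite_subset_distinct)

lemma flag_eq_chain_of_iff:
  assumes G: "G \<in> flags n f" and J: "set J \<subseteq> {..n}" and length_G: "length G = Suc (length J)"
    and \<tau>: "\<tau> permutes {..<length J}"
  shows "G = chain_of f J \<tau> \<longleftrightarrow>
    (\<forall>k<length J. J ! \<tau> k \<in> localization (G ! Suc k) - localization (G ! k))"
proof -
  have J_le: "J ! \<tau> k \<le> n" if "k < length J" for k
    using that J permutes_in_image[OF \<tau>, of k] by (auto dest: nth_mem)
  have step_iff: "J ! \<tau> k \<in> localization (G ! Suc k) - localization (G ! k) \<longleftrightarrow>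
      G ! Suc k = G ! k \<inter> hyp f (J ! \<tau> k)" if "k < length J" for k
  proof -
    have "G ! Suc k \<subset> G ! k" using that length_G flag_step[OF G, of k] by simp
    moreover have "G ! Suc k = G ! k \<inter> hyp f (J ! \<tau> k)"
      if "G ! Suc k \<subseteq> hyp f (J ! \<tau> k)" "\<not> G ! k \<subseteq> hyp f (J ! \<tau> k)"
      using that \<open>k < length J\<close> \<open>G ! Suc k \<subset> G ! k\<close> length_G J_le
      by (intro cover_eq_inter_hyp) (auto simp: flag_nth[OF G] flag_codim[OF G])
    ultimately show ?thesis
      using J_le that unfolding localization_def by blast
  qed
  have "G = chain_of f J \<tau> \<longleftrightarrow> (\<forall>k\<le>length J. G ! k = (\<Inter>i<k. hyp f (J ! \<tau> i)))"
    by (auto simp: list_eq_iff_nth_eq chain_of_def length_G less_Suc_eq_le simp del: upt_Suc)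
  also have "\<dots> \<longleftrightarrow> (\<forall>k<length J. G ! Suc k = G ! k \<inter> hyp f (J ! \<tau> k))"
  proof (intro iffI allI impI)
    fix k assume "\<forall>k\<le>length J. G ! k = (\<Inter>i<k. hyp f (J ! \<tau> i))" "k < length J"
    then show "G ! Suc k = G ! k \<inter> hyp f (J ! \<tau> k)"
      by (auto simp: lessThan_Suc)
  next
    fix k assume "\<forall>k<length J. G ! Suc k = G ! k \<inter> hyp f (J ! \<tau> k)" "k \<le> length J"
    then show "G ! k = (\<Inter>i<k. hyp f (J ! \<tau> i))"
    proof (induction k)
      case 0
      show ?case by (subst flag_eq_UNIV_Cons[OF G]) simp
    qed (auto simp: lessThan_Suc)
  qed
  finally show ?thesis using step_iff by simp
qed

lemma chain_of_inj:
  assumes G: "G \<in> flags n f" and J: "set J \<subseteq> {..n}" and length_G: "length G = Suc (length J)"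
    and \<sigma>: "\<sigma> permutes {..<length J}" "G = chain_of f J \<sigma>"
    and \<tau>: "\<tau> permutes {..<length J}" "G = chain_of f J \<tau>"
  shows "\<sigma> = \<tau>"
proof (rule ext)
  fix k
  show "\<sigma> k = \<tau> k"
  proof (cases "k < length J")
    case True
    have "\<sigma> k \<in> \<tau> ` {..<length J}"
      using True permutes_in_image[OF \<sigma>(1), of k] permutes_image[OF \<tau>(1)] by simp
    then obtain l where l: "l < length J" "\<sigma> k = \<tau> l"
      by auto
    have "J ! \<tau> l \<in> localization (G ! Suc k) - localization (G ! k)"
      using flag_eq_chain_of_iff[OF G J length_G \<sigma>(1)] \<sigma>(2) True l(2) by metis
    moreover have "J ! \<tau> l \<in> localization (G ! Suc l) - localization (G ! l)"
      using flag_eq_chain_of_iff[OF G J length_G \<tau>(1)] \<tau>(2) l(1) by blast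
    ultimately have "\<not> Suc k \<le> l" "\<not> Suc l \<le> k"
      using True l(1) length_G flag_antimono[OF G, of "Suc k" l] flag_antimono[OF G, of "Suc l" k]
      by (auto dest: localization_antimono)
    then show ?thesis using l(2) by (simp add: not_less_eq_eq)
  next
    case False
    then show ?thesis using \<sigma>(1) \<tau>(1) by (simp add: permutes_not_in)
  qed
qed

lemma flag_eval_eq_sum:
  assumes "G \<in> flags n f" "set J \<subseteq> {..n}" "length G = Suc (length J)"
  shows "flag_eval f G J =
    (\<Sum>\<tau> | \<tau> permutes {..<length J}. of_int (sign \<tau>) * of_bool (G = chain_of f J \<tau>))"
proof (cases "\<exists>\<tau>. \<tau> permutes {..<length J} \<and> G = chain_of f J \<tau>")
  case True
  then obtain \<tau> where \<tau>: "\<tau> permutes {..<length J}" "G = chain_of f J \<tau>" by blast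
  then have unique: "\<sigma> = \<tau>" if "\<sigma> permutes {..<length J}" "G = chain_of f J \<sigma>" for \<sigma>
    using that chain_of_inj[OF assms] by blast
  have "{\<sigma>. \<sigma> permutes {..<length J}} \<inter> {\<sigma>. G = chain_of f J \<sigma>} = {\<tau>}"
    using \<tau> unique by blast
  moreover have "(THE \<sigma>. \<sigma> permutes {..<length J} \<and> G = chain_of f J \<sigma>) = \<tau>"
    using \<tau> unique by (intro the_equality) blast+
  ultimately show ?thesis
    unfolding flag_eval_def if_P[OF True] by (simp add: finite_permutations)
next
  case False
  have "flag_eval f G J = 0"
    unfolding flag_eval_def if_not_P[OF False] ..
  moreover have "{\<sigma>. \<sigma> permutes {..<length J}} \<inter> {\<sigma>. G = chain_of f J \<sigma>} = {}"
    using False by blast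
  ultimately show ?thesis by (simp add: finite_permutations)
qed

lemma flag_eval_eq_alternant:
  assumes G: "G \<in> flags n f" and J: "set J \<subseteq> {..n}"
  shows "flag_eval f G J = alternant (map \<chi> (tl G)) J"
proof (cases "length G = Suc (length J)")
  case True
  let ?D = "\<lambda>k. localization (G ! Suc k) - localization (G ! k)"
  have "0 # map \<chi> (tl G) = map \<chi> G"
    by (subst (2) flag_eq_UNIV_Cons[OF G]) (simp add: fun_eq_iff)
  then have "alternant (map \<chi> (tl G)) J = alternant (map2 (-) (map \<chi> (tl G)) (map \<chi> G)) J"
    using alternant_successive_differences[of "map \<chi> (tl G)" J] by simp
  also have "map2 (-) (map \<chi> (tl G)) (map \<chi> G) = map (\<lambda>k. indicator (?D k)) [0..<length J]"
  proof (rule nth_equalityI)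
    fix k assume "k < length (map2 (-) (map \<chi> (tl G)) (map \<chi> G))"
    then have k: "k < length J" using True by simp
    then have "localization (G ! k) \<subseteq> localization (G ! Suc k)"
      using True flag_step[OF G, of k] by (intro localization_antimono) auto
    then show "map2 (-) (map \<chi> (tl G)) (map \<chi> G) ! k = map (\<lambda>k. indicator (?D k)) [0..<length J] ! k"
      using k True by (auto simp: nth_tl fun_eq_iff indicator_def)
  qed (use True in simp)
  also have "alternant \<dots> J = (\<Sum>\<tau> | \<tau> permutes {..<length J}.
      of_int (sign \<tau>) * of_bool (\<forall>k<length J. J ! \<tau> k \<in> ?D k))"
    by (subst alternant_leibniz) (simp_all add: indicator_def prod_of_bool Ball_def)
  also have "\<dots> = flag_eval f G J"
    unfolding flag_eval_eq_sum[OF G J True]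
    by (intro sum.cong refl) (simp add: flag_eq_chain_of_iff[OF G J True])
  finally show ?thesis by simp
next
  case False
  then have "length (tl G) \<noteq> length J"
    using flag_nonempty[OF G] by (cases G) auto
  moreover have "G \<noteq> chain_of f J \<sigma>" for \<sigma>
    using False by (auto simp: chain_of_def)
  ultimately show ?thesis
    by (simp add: flag_eval_def alternant_length_neq)
qed

section \<open>The pairing as a limit\<close>

lemma f_power_sum:
  "j \<le> n \<Longrightarrow> f j (\<Sum>i<N. t ^ i *s w i) = poly (\<Sum>i<N. monom (f j (w i)) i) t"
  by (simp add: f_sum f_scale poly_sum poly_monom mult.commute)

lemma generic_point:
  assumes X: "X \<in> intersections n f"
  shows "\<exists>w\<in>X. \<forall>j\<le>n. f j w = 0 \<longleftrightarrow> X \<subseteq> hyp f j"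
proof -
  have "\<forall>j. \<exists>y\<in>X. f j y = 0 \<longrightarrow> X \<subseteq> hyp f j"
    using zero_in_intersection[OF X] by (auto simp: hyp_def)
  then obtain y where y: "y j \<in> X" "f j (y j) = 0 \<Longrightarrow> X \<subseteq> hyp f j" for j by metis
  define w where "w t = (\<Sum>i<Suc n. t ^ i *s y i)" for t
  have w_in_X: "w t \<in> X" for t
    unfolding w_def using y(1) subspace_intersection[OF X]
    by (intro vec.subspace_sum vec.subspace_scale)
  have "\<forall>\<^sub>F t in at_infinity. f j (w t) \<noteq> 0" if "j \<le> n" "\<not> X \<subseteq> hyp f j" for j
    unfolding w_def f_power_sum[OF \<open>j \<le> n\<close>]
  proof (rule eventually_poly_neq_0_at_infinity)
    have "coeff (\<Sum>i<Suc n. monom (f j (y i)) i) j \<noteq> 0"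
      unfolding coeff_sum_lessThan_monom using that y(2)[of j] by auto
    then show "(\<Sum>i<Suc n. monom (f j (y i)) i) \<noteq> 0" by (metis coeff_0)
  qed
  then have "\<forall>\<^sub>F t in at_infinity. \<forall>j\<in>{j. j \<le> n \<and> \<not> X \<subseteq> hyp f j}. f j (w t) \<noteq> 0"
    by (intro eventually_ball_finite) auto
  then obtain t where "\<forall>j\<in>{j. j \<le> n \<and> \<not> X \<subseteq> hyp f j}. f j (w t) \<noteq> 0"
    using eventually_happens' trivial_limit_at_infinity by blast
  then show ?thesis
    using w_in_X by (intro bexI[of _ "w t"]) (auto simp: hyp_def)
qed

text \<open>With \<open>w\<^sub>i\<close> generic in the \<open>i\<close>-th space of the flag, take \<open>v\<^sub>k(t) = \<Sum>\<^sub>i\<^sub><\<^sub>k t\<^sup>i w\<^sub>i\<close>. The ratio of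
  \<open>f\<^sub>j(v\<^sub>k(t))\<close> to the value of \<open>f\<^sub>j\<close> at the full sum tends to \<open>1\<close> if all the omitted \<open>w\<^sub>i\<close>, or
  equivalently the \<open>k\<close>-th space, lie in the hyperplane, and to \<open>0\<close> otherwise.\<close>

lemma flag_degeneration:
  assumes G: "G \<in> flags n f"
  obtains v :: "nat \<Rightarrow> complex \<Rightarrow> complex^'m"
  where "\<forall>\<^sub>F t in at_infinity. v (length G) t \<in> arr_complement n f"
    and "\<And>j k. j \<le> n \<Longrightarrow> k < length G \<Longrightarrow>
      ((\<lambda>t. f j (v k t) / f j (v (length G) t)) \<longlongrightarrow> \<chi> (G ! k) j) at_infinity"
proof -
  let ?N = "length G"
  have "\<forall>k<?N. \<exists>w. \<forall>j\<le>n. f j w = 0 \<longleftrightarrow> G ! k \<subseteq> hyp f j"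
    using generic_point flag_nth[OF G] by blast
  then obtain w where w: "f j (w k) = 0 \<longleftrightarrow> G ! k \<subseteq> hyp f j" if "k < ?N" "j \<le> n" for j k
    by metis
  define v where "v k t = (\<Sum>i<k. t ^ i *s w i)" for k and t :: complex
  define q where "q j = (\<Sum>i<?N. monom (f j (w i)) i)" for j
  have f_v: "f j (v k t) = poly (poly_cutoff k (q j)) t" if "j \<le> n" "k \<le> ?N" for j k t
    using that by (simp add: v_def q_def f_power_sum poly_cutoff_sum_lessThan_monom)
  have "poly_cutoff k (q j) = q j \<longleftrightarrow> (\<forall>i\<in>{k..<?N}. f j (w i) = 0)" for j k
    by (auto simp: poly_eq_iff coeff_poly_cutoff q_def coeff_sum_lessThan_monom)
  then have cutoff: "poly_cutoff k (q j) = q j \<longleftrightarrow> j \<in> localization (G ! k)"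
    if "j \<le> n" "k < ?N" for j k
    using that w flag_antimono[OF G, of k] by (fastforce simp: localization_def)
  have cutoff_N: "poly_cutoff ?N (q j) = q j" for j
    by (simp add: q_def poly_cutoff_sum_lessThan_monom)
  have "G ! 0 = UNIV" by (subst flag_eq_UNIV_Cons[OF G]) simp
  then have q_neq_0: "q j \<noteq> 0" if "j \<le> n" for j
    using that cutoff[of j 0] flag_nonempty[OF G] by auto
  have "\<forall>\<^sub>F t in at_infinity. \<forall>j\<in>{..n}. f j (v ?N t) \<noteq> 0"
    using eventually_poly_neq_0_at_infinity[OF q_neq_0]
    by (intro eventually_ball_finite) (simp_all add: f_v cutoff_N)
  then have "\<forall>\<^sub>F t in at_infinity. v ?N t \<in> arr_complement n f"
    by (rule eventually_mono) (auto simp: arr_complement_def hyp_def)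
  moreover have "((\<lambda>t. f j (v k t) / f j (v ?N t)) \<longlongrightarrow> \<chi> (G ! k) j) at_infinity"
    if "j \<le> n" "k < ?N" for j k
    using poly_cutoff_ratio_tendsto[OF q_neq_0[OF \<open>j \<le> n\<close>], of k] that
    by (simp add: f_v cutoff_N cutoff indicator_def)
  ultimately show ?thesis by (rule that)
qed

lemma flag_eval_limit:
  assumes G: "G \<in> flags n f"
  obtains x :: "complex \<Rightarrow> complex^'m" and vs
  where "\<And>J. set J \<subseteq> {..n} \<Longrightarrow>
    ((\<lambda>t. omega_mono n f J (x t) (vs t)) \<longlongrightarrow> flag_eval f G J) at_infinity"
proof -
  let ?N = "length G"
  obtain v :: "nat \<Rightarrow> complex \<Rightarrow> complex^'m"
    where complement: "\<forall>\<^sub>F t in at_infinity. v ?N t \<in> arr_complement n f"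
      and ratio: "\<And>j k. j \<le> n \<Longrightarrow> k < ?N \<Longrightarrow>
        ((\<lambda>t. f j (v k t) / f j (v ?N t)) \<longlongrightarrow> \<chi> (G ! k) j) at_infinity"
    using flag_degeneration[OF G] by blast
  let ?vs = "\<lambda>t. map (\<lambda>k. v k t) [1..<?N]"
  show ?thesis
  proof (rule that)
    fix J assume J: "set J \<subseteq> {..n}"
    have "((\<lambda>t. alternant (map (\<lambda>u j. f j u / f j (v ?N t)) (?vs t)) J) \<longlongrightarrow>
        alternant (map \<chi> (tl G)) J) at_infinity"
      using J by (intro tendsto_alternant) (auto simp: nth_tl intro!: ratio)
    moreover have "\<forall>\<^sub>F t in at_infinity. alternant (map (\<lambda>u j. f j u / f j (v ?N t)) (?vs t)) J =
        omega_mono n f J (v ?N t) (?vs t)"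
      using complement by eventually_elim (simp add: omega_mono_eq_alternant)
    ultimately show "((\<lambda>t. omega_mono n f J (v ?N t) (?vs t)) \<longlongrightarrow> flag_eval f G J) at_infinity"
      unfolding flag_eval_eq_alternant[OF G J] by (rule Lim_transform_eventually)
  qed
qed

lemma flag_eval_linear_relation:
  assumes G: "G \<in> flags n f"
    and K: "\<And>t. t \<in> T \<Longrightarrow> set (K t) \<subseteq> {..n}" and K': "\<And>t. t \<in> T' \<Longrightarrow> set (K' t) \<subseteq> {..n}"
    and forms_eq: "(\<lambda>x vs. \<Sum>t\<in>T. b t * omega_mono n f (K t) x vs) =
      (\<lambda>x vs. \<Sum>t\<in>T'. b' t * omega_mono n f (K' t) x vs)"
  shows "(\<Sum>t\<in>T. b t * flag_eval f G (K t)) = (\<Sum>t\<in>T'. b' t * flag_eval f G (K' t))"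
proof -
  obtain x :: "complex \<Rightarrow> complex^'m" and vs where limit: "\<And>J. set J \<subseteq> {..n} \<Longrightarrow>
      ((\<lambda>t. omega_mono n f J (x t) (vs t)) \<longlongrightarrow> flag_eval f G J) at_infinity"
    using flag_eval_limit[OF G] by blast
  have "((\<lambda>s. \<Sum>t\<in>T. b t * omega_mono n f (K t) (x s) (vs s)) \<longlongrightarrow>
      (\<Sum>t\<in>T. b t * flag_eval f G (K t))) at_infinity"
    by (intro tendsto_intros limit K)
  moreover have "((\<lambda>s. \<Sum>t\<in>T'. b' t * omega_mono n f (K' t) (x s) (vs s)) \<longlongrightarrow>
      (\<Sum>t\<in>T'. b' t * flag_eval f G (K' t))) at_infinity"
    by (intro tendsto_intros limit K')
  ultimately show ?thesis
    unfolding fun_cong[OF fun_cong[OF forms_eq]]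
    by (rule tendsto_unique[OF trivial_limit_at_infinity])
qed

section \<open>The pairing on free flags\<close>

definition free_pairing :: "((complex^'m) set list \<Rightarrow> complex) \<Rightarrow> nat list \<Rightarrow> complex" where
  "free_pairing c J = (\<Sum>G\<in>flags n f. c G * flag_eval f G J)"

interpretation free_pairing:
  Vector_Spaces.linear "\<lambda>c g x. c * g x" "(*)" "\<lambda>c. free_pairing c J" for J
  by unfold_locales
    (simp_all add: free_pairing_def algebra_simps sum.distrib sum_distrib_left)

lemma free_pairing_flag_vec: "G \<in> flags n f \<Longrightarrow> free_pairing (flag_vec G) J = flag_eval f G J"
  by (simp add: free_pairing_def flag_vec_def if_distrib[of "\<lambda>z. z * _"] cong: if_cong)

lemma free_pairing_repeated:
  "set J \<subseteq> {..n} \<Longrightarrow> \<not> distinct J \<Longrightarrow> free_pairing c J = 0"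
  by (simp add: free_pairing_def flag_eval_eq_alternant alternant_repeated_column)

lemma free_pairing_move_to_front:
  assumes J: "set J \<subseteq> {..n}" and k: "k < length J"
  shows "free_pairing c J = (-1) ^ k * free_pairing c (J ! k # nths J (- {k}))"
proof -
  have front: "set (J ! k # nths J (- {k})) \<subseteq> {..n}"
    using J nth_mem[OF k] set_nths_subset[of J "- {k}"] by auto
  show ?thesis
    unfolding free_pairing_def sum_distrib_left
  proof (intro sum.cong refl)
    fix G assume G: "G \<in> flags n f"
    show "c G * flag_eval f G J = (-1) ^ k * (c G * flag_eval f G (J ! k # nths J (- {k})))"
      unfolding flag_eval_eq_alternant[OF G J] flag_eval_eq_alternant[OF G front]
        alternant_move_to_front[OF k, of "map \<chi> (tl G)"] by simp
  qed
qed

lemma sum_alternant_covers: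
  assumes G: "G \<in> flags n f" and "Z \<subseteq> last G"
    and "\<And>X. X \<in> intersections n f \<Longrightarrow> codim X = length G \<Longrightarrow> X \<noteq> Z"
  shows "(\<Sum>X\<in>covers_between (last G) Z. alternant (map \<chi> (tl G) @ \<chi> X # us) J) =
    alternant (map \<chi> (tl G) @ \<chi> Z # us) J"
proof -
  let ?C = "covers_between (last G) Z"
  have "(\<lambda>j. \<Sum>X\<in>?C. \<chi> X j) = (\<lambda>j. (of_nat (card ?C) - 1) * \<chi> (last G) j + \<chi> Z j)"
    using assms flag_last[OF G] flag_codim_last[OF G]
    by (intro ext sum_localization_indicator_covers) simp_all
  then have "(\<Sum>X\<in>?C. alternant (map \<chi> (tl G) @ \<chi> X # us) J) =
      (of_nat (card ?C) - 1) * alternant (map \<chi> (tl G) @ \<chi> (last G) # us) J +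
      alternant (map \<chi> (tl G) @ \<chi> Z # us) J"
    by (simp only: alternant_row_sum[symmetric] alternant_row_add_scale)
  moreover have "alternant (map \<chi> (tl G) @ \<chi> (last G) # us) J = 0"
  proof (cases "tl G = []")
    case True
    then have "last G = UNIV" by (subst flag_eq_UNIV_Cons[OF G]) simp
    moreover have "indicator {} = (0 :: nat \<Rightarrow> complex)" by (simp add: fun_eq_iff)
    ultimately show ?thesis by (intro alternant_row_zero) simp
  next
    case False
    then have "last G \<in> set (tl G)" by (metis last_in_set last_tl)
    then show ?thesis by (intro alternant_repeated_row) auto
  qed
  ultimately show ?thesis by simp
qed

lemma free_pairing_relator:
  assumes relator: "r \<in> flag_relators n f" and J: "set J \<subseteq> {..n}"
  shows "free_pairing r J = 0"
proof -
  obtain Ys Zs where Ys: "Ys \<in> flags n f" and Zs: "Zs \<noteq> []" "hd Zs \<subset> last Ys"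
    and chain: "codim_chain (length Ys + 1) Zs"
    and r: "r = (\<Sum>X | X \<in> intersections n f \<and> X \<subset> last Ys \<and> hd Zs \<subset> X \<and> codim X = length Ys.
      flag_vec (Ys @ X # Zs))"
    using relator unfolding flag_relators_def codim_chain_def by blast
  have covers: "{X. X \<in> intersections n f \<and> X \<subset> last Ys \<and> hd Zs \<subset> X \<and> codim X = length Ys} =
      covers_between (last Ys) (hd Zs)"
    using flag_codim_last[OF Ys] by (simp add: covers_between_def)
  have flag: "Ys @ X # Zs \<in> flags n f" if "X \<in> covers_between (last Ys) (hd Zs)" for X
    using that Ys chain flag_codim_last[OF Ys]
    by (simp add: covers_between_def flags_iff_codim_chain codim_chain_append codim_chain_Cons)
  have "codim (hd Zs) \<noteq> length Ys"
    using chain Zs(1) by (cases Zs) (simp_all add: codim_chain_Cons)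
  have "free_pairing r J = (\<Sum>X\<in>covers_between (last Ys) (hd Zs). flag_eval f (Ys @ X # Zs) J)"
    unfolding r covers free_pairing.sum by (intro sum.cong refl free_pairing_flag_vec flag)
  also have "\<dots> = (\<Sum>X\<in>covers_between (last Ys) (hd Zs).
      alternant (map \<chi> (tl Ys) @ \<chi> X # map \<chi> Zs) J)"
    using flag_nonempty[OF Ys]
    by (intro sum.cong refl) (simp add: flag_eval_eq_alternant[OF flag J])
  also have "\<dots> = alternant (map \<chi> (tl Ys) @ \<chi> (hd Zs) # map \<chi> Zs) J"
    using Zs(2) \<open>codim (hd Zs) \<noteq> length Ys\<close> by (intro sum_alternant_covers[OF Ys]) auto
  also have "\<dots> = 0"
    using Zs(1) by (intro alternant_repeated_row) (cases Zs; simp)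
  finally show ?thesis .
qed

lemma free_pairing_flag_rel:
  assumes "(c, c') \<in> flag_rel n f" and J: "set J \<subseteq> {..n}"
  shows "free_pairing c J = free_pairing c' J"
proof -
  have "c - c' \<in> fun_vs.span (flag_relators n f)"
    using assms(1) by (simp add: flag_rel_def)
  then have "free_pairing (c - c') J = 0"
    by (rule free_pairing.eq_0_on_span[rotated]) (rule free_pairing_relator[OF _ J])
  then show ?thesis by (simp add: free_pairing.diff)
qed

section \<open>The flag differential\<close>

lemma append_cover_in_flags:
  "G \<in> flags n f \<Longrightarrow> X \<in> covers_between (last G) {} \<Longrightarrow> G @ [X] \<in> flags n f"
  using flag_codim_last[of G]
  by (simp add: covers_between_def flags_iff_codim_chain codim_chain_append codim_chain_Cons)

lemma pre_diff_eq_sum: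
  "pre_diff n f c =
    (\<Sum>G\<in>flags n f. (\<lambda>G'. c G * (\<Sum>X\<in>covers_between (last G) {}. flag_vec (G @ [X])) G'))"
proof -
  have "{X. X \<in> intersections n f \<and> X \<subset> last G \<and> codim X = length G} = covers_between (last G) {}"
    if "G \<in> flags n f" for G
    using flag_codim_last[OF that] zero_in_intersection by (auto simp: covers_between_def)
  then show ?thesis
    by (intro ext) (simp add: pre_diff_def sum_fun_apply)
qed

lemma pre_diff_in_free_flags: "pre_diff n f c \<in> free_flags n f"
proof -
  have "flag_vec (G @ [X]) G' = 0"
    if "G' \<notin> flags n f" "G \<in> flags n f" "X \<in> covers_between (last G) {}" for G G' X
    using that append_cover_in_flags by (auto simp: flag_vec_def)
  then show ?thesis
    by (simp add: free_flags_def pre_diff_eq_sum sum_fun_apply)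
qed

lemma sum_flag_eval_extend:
  assumes G: "G \<in> flags n f" and J: "set J \<subseteq> {..n}"
  shows "(\<Sum>X\<in>covers_between (last G) {}. flag_eval f (G @ [X]) J) =
    (\<Sum>k<length J. (-1) ^ (length J - 1 + k) * flag_eval f G (nths J (- {k})))"
proof -
  have "(\<Sum>X\<in>covers_between (last G) {}. flag_eval f (G @ [X]) J) =
      (\<Sum>X\<in>covers_between (last G) {}. alternant (map \<chi> (tl G) @ [\<chi> X]) J)"
    using flag_nonempty[OF G]
    by (intro sum.cong refl) (simp add: flag_eval_eq_alternant[OF append_cover_in_flags[OF G] J])
  also have "\<dots> = alternant (map \<chi> (tl G) @ [\<chi> {}]) J"
    using zero_in_intersection by (intro sum_alternant_covers[OF G]) auto
  also have "\<dots> = (\<Sum>k<length J. (-1) ^ (length (tl G) + k) *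
      alternant (map \<chi> (tl G)) (nths J (- {k})))"
    unfolding alternant_row_append_expansion using J nth_mem
    by (intro sum.cong) (fastforce simp: indicator_def)+
  also have "\<dots> = (\<Sum>k<length J. (-1) ^ (length J - 1 + k) * flag_eval f G (nths J (- {k})))"
  proof (intro sum.cong refl)
    fix k assume "k \<in> {..<length J}"
    moreover have "set (nths J (- {k})) \<subseteq> {..n}"
      using J set_nths_subset[of J] by blast
    ultimately show "(-1) ^ (length (tl G) + k) * alternant (map \<chi> (tl G)) (nths J (- {k})) =
        (-1) ^ (length J - 1 + k) * flag_eval f G (nths J (- {k}))"
      by (cases "length (tl G) = length J - 1")
        (simp_all add: flag_eval_eq_alternant[OF G] alternant_length_neq)
  qed
  finally show ?thesis .
qed

lemma free_pairing_pre_diff: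
  assumes J: "set J \<subseteq> {..n}"
  shows "free_pairing (pre_diff n f c) J =
    (\<Sum>k<length J. (-1) ^ (length J - 1 + k) * free_pairing c (nths J (- {k})))"
proof -
  have extend: "(\<Sum>X\<in>covers_between (last G) {}. free_pairing (flag_vec (G @ [X])) J) =
      (\<Sum>k<length J. (-1) ^ (length J - 1 + k) * flag_eval f G (nths J (- {k})))"
    if "G \<in> flags n f" for G
    unfolding sum_flag_eval_extend[OF that J, symmetric]
    by (intro sum.cong refl free_pairing_flag_vec append_cover_in_flags that)
  have "free_pairing (pre_diff n f c) J =
      (\<Sum>G\<in>flags n f. c G * (\<Sum>X\<in>covers_between (last G) {}. free_pairing (flag_vec (G @ [X])) J))"
    by (simp only: pre_diff_eq_sum free_pairing.sum free_pairing.scale)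
  also have "\<dots> = (\<Sum>G\<in>flags n f. c G *
      (\<Sum>k<length J. (-1) ^ (length J - 1 + k) * flag_eval f G (nths J (- {k}))))"
    by (intro sum.cong refl) (simp only: extend)
  also have "\<dots> = (\<Sum>k<length J. (-1) ^ (length J - 1 + k) * free_pairing c (nths J (- {k})))"
    unfolding free_pairing_def sum_distrib_left by (subst sum.swap) (simp add: mult_ac)
  finally show ?thesis .
qed

section \<open>The pairing on classes of flags\<close>

definition has_pairing ::
  "((complex^'m) set list \<Rightarrow> complex) set \<Rightarrow> (nat list \<Rightarrow> complex) \<Rightarrow> bool" where
  "has_pairing F P \<longleftrightarrow> F \<noteq> {} \<and> (\<forall>c\<in>F. \<forall>J. set J \<subseteq> {..n} \<longrightarrow> free_pairing c J = P J)"

lemma flag_space_has_pairing: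
  assumes "F \<in> flag_space n f"
  obtains c where "has_pairing F (free_pairing c)"
proof -
  obtain c where c: "c \<in> free_flags n f" "F = flag_rel n f `` {c}"
    using assms by (auto simp: flag_space_def elim: quotientE)
  then have "c \<in> F" by (simp add: flag_rel_def fun_vs.span_zero)
  then have "has_pairing F (free_pairing c)"
    using c(2) by (auto simp: has_pairing_def dest: free_pairing_flag_rel)
  then show ?thesis by (rule that)
qed

lemma has_pairing_flag_diff:
  assumes "has_pairing G Q"
  shows "has_pairing (flag_diff n f G)
    (\<lambda>J. \<Sum>k<length J. (-1) ^ (length J - 1 + k) * Q (nths J (- {k})))"
  unfolding has_pairing_def
proof (intro conjI ballI allI impI)
  obtain c where "c \<in> G" using assms by (auto simp: has_pairing_def)
  moreover have "(pre_diff n f c, pre_diff n f c) \<in> flag_rel n f"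
    by (simp add: flag_rel_def pre_diff_in_free_flags fun_vs.span_zero)
  ultimately show "flag_diff n f G \<noteq> {}" unfolding flag_diff_def by blast
next
  fix g J assume "g \<in> flag_diff n f G" and J: "set J \<subseteq> {..n}"
  then obtain c where c: "c \<in> G" "(pre_diff n f c, g) \<in> flag_rel n f"
    by (auto simp: flag_diff_def)
  have "free_pairing c (nths J (- {k})) = Q (nths J (- {k}))" for k
    using assms c(1) J set_nths_subset[of J] unfolding has_pairing_def by blast
  then show "free_pairing g J = (\<Sum>k<length J. (-1) ^ (length J - 1 + k) * Q (nths J (- {k})))"
    using free_pairing_flag_rel[OF c(2) J] free_pairing_pre_diff[OF J, of c] by simp
qed

lemma flag_pairing_eq:
  assumes F: "has_pairing F P"
    and T: "finite T" "\<And>t. t \<in> T \<Longrightarrow> set (K t) \<subseteq> {..n}"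
  shows "flag_pairing n f F (\<lambda>x vs. \<Sum>t\<in>T. b t * omega_mono n f (K t) x vs) =
    (\<Sum>t\<in>T. b t * P (K t))"
proof -
  let ?I = "increasing_tuples n" and ?u = "\<lambda>x vs. \<Sum>t\<in>T. b t * omega_mono n f (K t) x vs"
  have pairing_value: "(\<Sum>G\<in>flags n f. \<Sum>J\<in>?I. c G * b' J * flag_eval f G J) =
      (\<Sum>t\<in>T. b t * P (K t))"
    if c: "c \<in> F" and b': "?u = (\<lambda>x vs. \<Sum>J\<in>?I. b' J * omega_mono n f J x vs)" for c b'
  proof -
    have "(\<Sum>G\<in>flags n f. \<Sum>J\<in>?I. c G * b' J * flag_eval f G J) =
        (\<Sum>G\<in>flags n f. c G * (\<Sum>J\<in>?I. b' J * flag_eval f G J))"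
      by (simp add: sum_distrib_left mult.assoc)
    also have "\<dots> = (\<Sum>G\<in>flags n f. c G * (\<Sum>t\<in>T. b t * flag_eval f G (K t)))"
      using T(2) flag_eval_linear_relation[OF _ _ _ b'[symmetric]]
      by (intro sum.cong refl) (simp add: increasing_tuples_iff)
    also have "\<dots> = (\<Sum>t\<in>T. b t * free_pairing c (K t))"
      unfolding free_pairing_def sum_distrib_left by (subst sum.swap) (simp add: mult_ac)
    also have "\<dots> = (\<Sum>t\<in>T. b t * P (K t))"
      using F T(2) c by (simp add: has_pairing_def)
    finally show ?thesis .
  qed
  obtain c where c: "c \<in> F" using F by (auto simp: has_pairing_def)
  obtain b' where b': "?u = (\<lambda>x vs. \<Sum>J\<in>?I. b' J * omega_mono n f J x vs)"
    using omega_mono_combination_eq_increasing[of T K n b f, OF T] by blast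
  show ?thesis
    unfolding flag_pairing_def
  proof (rule the_equality)
    show "\<exists>c\<in>F. \<exists>b'. ?u = (\<lambda>x vs. \<Sum>J\<in>?I. b' J * omega_mono n f J x vs) \<and>
        (\<Sum>t\<in>T. b t * P (K t)) = (\<Sum>G\<in>flags n f. \<Sum>J\<in>?I. c G * b' J * flag_eval f G J)"
      by (intro bexI[OF _ c] exI[of _ b'] conjI b' pairing_value[OF c b', symmetric])
  qed (use pairing_value in blast)
qed

lemma flag_pairing_omega_mono:
  assumes "has_pairing F P" "set J \<subseteq> {..n}"
  shows "flag_pairing n f F (omega_mono n f J) = P J"
  using flag_pairing_eq[OF assms(1), of "{()}" "\<lambda>_. J" "\<lambda>_. 1"] assms(2) by simp

lemma flag_pairing_wedge_omega_weight:
  assumes "has_pairing F P" "set I \<subseteq> {..n}"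
  shows "flag_pairing n f F (wedge (omega_weight n f a) (omega_mono n f I)) =
    (\<Sum>i\<le>n. a i * P (i # I))"
  unfolding wedge_omega_weight omega_mono_Cons[symmetric]
  using assms by (intro flag_pairing_eq) auto

section \<open>The contravariant form\<close>

lemma contravariant_form_eq:
  assumes "has_pairing F P" "has_pairing F' P'"
  shows "contravariant_form n f a F F' =
    (\<Sum>J\<in>increasing_tuples n. prod_list (map a J) * P J * P' J)"
proof -
  have "contravariant_form n f a F F' =
      (\<Sum>p\<le>n + 1. \<Sum>J | J \<in> increasing_tuples n \<and> length J = p. prod_list (map a J) * P J * P' J)"
    unfolding contravariant_form_def contravariant_deg_def
    by (intro sum.cong refl)
      (auto simp: increasing_tuples_iff prod.list_conv_set_nth atLeast0LessThan
        flag_pairing_omega_mono[OF assms(1)] flag_pairing_omega_mono[OF assms(2)])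
  also have "\<dots> = (\<Sum>J\<in>increasing_tuples n. prod_list (map a J) * P J * P' J)"
    using length_increasing_tuple by (intro sum.group) fastforce+
  finally show ?thesis .
qed

lemma contravariant_form_flag_diff:
  assumes "F \<in> flag_space n f" "G \<in> flag_space n f"
  shows "contravariant_form n f a F (flag_diff n f G) =
    (\<Sum>I\<in>increasing_tuples n. (-1) ^ length I * prod_list (map a I) *
      flag_pairing n f G (omega_mono n f I) *
      flag_pairing n f F (wedge (omega_weight n f a) (omega_mono n f I)))"
proof -
  let ?I = "increasing_tuples n"
  obtain c where F: "has_pairing F (free_pairing c)"
    using assms(1) by (rule flag_space_has_pairing)
  obtain d where G: "has_pairing G (free_pairing d)"
    using assms(2) by (rule flag_space_has_pairing)
  let ?P = "free_pairing c" and ?Q = "free_pairing d"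
  let ?h = "\<lambda>i I. a i * ?P (i # I) * ((-1) ^ length I * prod_list (map a I) * ?Q I)"
  have summand: "prod_list (map a J) * ?P J * ((-1) ^ (length J - 1 + k) * ?Q (nths J (- {k}))) =
      ?h (J ! k) (nths J (- {k}))" if "J \<in> ?I" "k < length J" for J k
  proof -
    have "?P J = (-1) ^ k * ?P (J ! k # nths J (- {k}))"
      using that by (intro free_pairing_move_to_front) (simp_all add: increasing_tuples_iff)
    then show ?thesis
      using that(2) unfolding power_add prod_list_map_nths_Compl_singleton[OF that(2)] by simp
  qed
  have "contravariant_form n f a F (flag_diff n f G) =
      (\<Sum>J\<in>?I. \<Sum>k<length J. ?h (J ! k) (nths J (- {k})))"
    unfolding contravariant_form_eq[OF F has_pairing_flag_diff[OF G]] sum_distrib_left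
    by (intro sum.cong refl summand) simp_all
  also have "\<dots> = (\<Sum>I\<in>?I. \<Sum>i\<in>{..n} - set I. ?h i I)"
    by (rule sum_increasing_tuples_delete)
  also have "\<dots> = (\<Sum>I\<in>?I. \<Sum>i\<le>n. ?h i I)"
    by (intro sum.cong refl sum.mono_neutral_left)
      (auto simp: free_pairing_repeated increasing_tuples_iff)
  also have "\<dots> = (\<Sum>I\<in>?I. (-1) ^ length I * prod_list (map a I) * ?Q I * (\<Sum>i\<le>n. a i * ?P (i # I)))"
    by (simp add: sum_distrib_left mult_ac)
  finally show ?thesis
    using F G by (simp add: increasing_tuples_iff flag_pairing_omega_mono
      flag_pairing_wedge_omega_weight)
qed

end

theorem theorem4p2:
  fixes n :: nat
    and f :: "nat \<Rightarrow> complex^'m \<Rightarrow> complex"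
    and a :: "nat \<Rightarrow> complex"
  assumes "central_arrangement n f"
  shows "\<forall>F \<in> Ann n f {wedge (omega_weight n f a) u | u. u \<in> OS_algebra n f}.
           \<forall>G \<in> flag_diff n f ` flag_space n f. contravariant_form n f a F G = 0"
proof safe
  interpret arrangement n f by unfold_locales (rule assms)
  fix F G
  assume F: "F \<in> Ann n f {wedge (omega_weight n f a) u | u. u \<in> OS_algebra n f}"
    and G: "G \<in> flag_space n f"
  have "flag_pairing n f F (wedge (omega_weight n f a) (omega_mono n f I)) = 0"
    if "I \<in> increasing_tuples n" for I
    using that F omega_mono_in_OS_algebra[of I n f] by (auto simp: Ann_def increasing_tuples_iff)
  then show "contravariant_form n f a F (flag_diff n f G) = 0"
    using F G by (simp add: Ann_def contravariant_form_flag_diff)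
qed

end
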